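(* Let $f$ be a positive differentiable function on $(0,1)$ such that $-f'$ is positive, increasing, convex, in the general case and integrable on $(0,1)$. Put $$U(x)=\int_0^1 f(t)\cos xt\,dt\quad(x>0),\qquad L=\lim_{t\to0+}[-f'(t)],\qquad M=\lim_{t\to1-}f(t).$$ Then $U(x)>0$ for $0<x\le\pi$, and $U$ has infinitely many zeros in $x>\pi$, all of which are simple and distributed as follows. (i) For any $L\ge0$, $M\ge0$, each of the intervals $$\big((2k-1)\pi,\,2k\pi\big),\quad\big(2k\pi,\,(2k+1/2)\pi\big),\qquad k=1,2,\dots,$$ contains exactly one zero of $U$, and $U$ has no positive zeros elsewhere. (ii) If either $L=0$ or $0<2L\le3\pi M$, then each of the intervals $$\big(k\pi,\,(k+1/2)\pi\big),\qquad k=1,2,\dots,$$ contains exactly one zero of $U$, and $U$ has no positive zeros elsewhere.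
   Context: A function $g$ on $(0,1)$ is said to be in the exceptional case if there exist finitely many rational points $0=r_0<r_1<\cdots<r_N=1$ such that $g$ is constant on each open interval $(r_{k-1},r_k)$, $k=1,\dots,N$. Otherwise $g$ is said to be in the general case. "Increasing" is meant in the wide (non-strict) sense. *)

theory Defs
  imports "HOL-Analysis.Analysis"
begin

definition exceptional_case :: "(real \<Rightarrow> real) \<Rightarrow> bool" where
  "exceptional_case g \<longleftrightarrow>
     (\<exists>(N::nat) (r :: nat \<Rightarrow> real).
        r 0 = 0 \<and> r N = 1 \<and>
        (\<forall>k\<le>N. r k \<in> \<rat>) \<and>
        (\<forall>k\<in>{1..N}. r (k - 1) < r k) \<and>
        (\<forall>k\<in>{1..N}. g constant_on {r (k - 1)<..<r k}))"

definition general_case :: "(real \<Rightarrow> real) \<Rightarrow> bool" where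
  "general_case g \<longleftrightarrow> \<not> exceptional_case g"

text \<open>The functions \<open>f\<close> of interest live on the open unit interval only: the values of
  \<open>f :: real \<Rightarrow> real\<close> elsewhere are irrelevant junk.\<close>

definition cos_transform :: "(real \<Rightarrow> real) \<Rightarrow> real \<Rightarrow> real" where
  "cos_transform f x = integral {0<..<1} (\<lambda>t. f t * cos (x * t))"

definition simple_zero :: "(real \<Rightarrow> real) \<Rightarrow> real \<Rightarrow> bool" where
  "simple_zero F x \<longleftrightarrow> F x = 0 \<and> (\<exists>D. (F has_real_derivative D) (at x) \<and> D \<noteq> 0)"

end

(* Put g = -f'. Integration by parts gives x U(x) = V(x) = M sin x + int_0^1 g(t) sin(xt) dt. With
   A = int_0^1 g(t) sin(x(1-t)) dt and B = M + int_0^1 g(t) cos(x(1-t)) dt one has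
   V = B sin x - A cos x. Here A > 0, as g is increasing and not constant, so V has the sign of
   (-1)^(k+1) at k pi. At a zero of V one gets V' sin x > 0, so V always crosses zero in the same
   direction on (k pi, (k+1) pi) and has exactly one zero there. The half of the interval containing
   it is found from the sign of V at (k+1/2) pi: convexity makes the integral of g against a cosine
   over each full period nonnegative, and on the remaining part of the period g is compared with
   zero or with a line through (0, L). *)

theory Submission
  imports Defs
begin


text \<open>Measuring the phase from the endpoint 1 is what lets monotonicity give signs. Formally,
  let dG include the jump from 0 to L at the origin and put p = 1 - a, alpha = x p. Then x A and x
  (B - M) are the integrals of 1 - cos alpha and sin alpha against dG(a), and dG is a nonnegative
  measure. The claim V' sin x > 0 at a zero comes down to P^2 + Q^2 \<le> (A + P)^2, where x P and x
  Q are the integrals of p cos alpha and p sin alpha against dG. This is quadratic in G, so it is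
  obtained from linear inequalities, one for each direction of the vector (P, Q). The obstacle is
  that G may blow up at 1, so that dG may have infinite mass. Such statements are therefore proved
  for integrals of G times a kernel with nonnegative tail integrals, and differentiation in x is
  carried out on the integral of f, which stays bounded.\<close>

section \<open>Integrals of a monotone, possibly unbounded function against a continuous
  kernel\<close>

lemma integral_le_interior:
  fixes f g :: "real \<Rightarrow> real"
  assumes "f integrable_on {a..b}" "g integrable_on {a..b}"
    and "\<And>x. a < x \<Longrightarrow> x < b \<Longrightarrow> f x \<le> g x"
  shows "integral {a..b} f \<le> integral {a..b} g"
  unfolding integral_open_interval_real
  using assms by (intro integral_le) (auto simp: integrable_on_Icc_iff_Ioo)

text \<open>Nonnegativity makes \<open>G\<close> absolutely integrable, and that survives a bounded
  measurable factor. No bound on \<open>G\<close> is available, since -f' may blow up at 1.\<close>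

lemma integrable_mult_continuous:
  fixes G k :: "real \<Rightarrow> real"
  assumes G: "G integrable_on {a..b}" and nonneg: "\<And>t. t \<in> {a..b} \<Longrightarrow> 0 \<le> G t"
    and k: "continuous_on {a..b} k"
  shows "(\<lambda>t. G t * k t) integrable_on {a..b}"
proof -
  have "(\<lambda>t. k t * G t) absolutely_integrable_on {a..b}"
  proof (rule absolutely_integrable_bounded_measurable_product_real)
    show "k \<in> borel_measurable (lebesgue_on {a..b})"
      by (rule continuous_imp_measurable_on_sets_lebesgue) (use k in auto)
    show "bounded (k ` {a..b})"
      using compact_continuous_image[OF k] compact_imp_bounded by auto
    show "G absolutely_integrable_on {a..b}"
      using nonnegative_absolutely_integrable_1[OF G] nonneg by auto
  qed auto
  then show ?thesis
    by (simp add: absolutely_integrable_on_def mult.commute)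
qed

text \<open>Beyond \<open>t0\<close> monotonicity keeps \<open>G\<close> above \<open>G t0\<close>,
  so the integral there dominates that of a continuous positive function; before \<open>t0\<close>
  the integrand is nonnegative.\<close>

lemma integral_mult_pos:
  fixes G w :: "real \<Rightarrow> real"
  assumes mono: "mono_on {a<..<b} G" and nonneg: "\<And>t. a < t \<Longrightarrow> t < b \<Longrightarrow> 0 \<le> G t"
    and t0: "a < t0" "t0 < b" "0 < G t0"
    and w: "continuous_on {a..b} w" "\<And>t. a < t \<Longrightarrow> t < b \<Longrightarrow> 0 < w t"
    and int: "(\<lambda>t. G t * w t) integrable_on {a..b}"
  shows "0 < integral {a..b} (\<lambda>t. G t * w t)"
proof -
  have cw: "continuous_on {t0..b} w"
    using w(1) by (rule continuous_on_subset) (use t0 in auto)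
  have i1: "(\<lambda>t. G t * w t) integrable_on {a..t0}" and i2: "(\<lambda>t. G t * w t) integrable_on {t0..b}"
    using int t0 by (auto intro: integrable_on_subinterval)
  have "0 = integral {t0..b} (\<lambda>t. 0::real)" by simp
  also have "\<dots> < integral {t0..b} (\<lambda>t. G t0 * w t)"
    unfolding box_real(2)[symmetric]
    by (rule integral_less) (use t0 w cw in \<open>auto intro!: continuous_intros\<close>)
  also have "\<dots> \<le> integral {t0..b} (\<lambda>t. G t * w t)"
  proof (rule integral_le_interior[OF _ i2])
    show "(\<lambda>t. G t0 * w t) integrable_on {t0..b}"
      using cw by (intro integrable_continuous_real continuous_intros)
    fix t assume t: "t0 < t" "t < b"
    then have "G t0 \<le> G t"
      using mono t0 by (auto intro: mono_onD)
    then show "G t0 * w t \<le> G t * w t"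
      using w(2)[of t] t t0 by (intro mult_right_mono) auto
  qed
  also have "\<dots> \<le> integral {a..t0} (\<lambda>t. G t * w t) + integral {t0..b} (\<lambda>t. G t * w t)"
  proof -
    have "integral {a..t0} (\<lambda>t. 0::real) \<le> integral {a..t0} (\<lambda>t. G t * w t)"
      by (rule integral_le_interior[OF _ i1]) (use t0 w(2) nonneg in \<open>auto intro!: mult_nonneg_nonneg simp: less_imp_le\<close>)
    then show ?thesis by simp
  qed
  also have "\<dots> = integral {a..b} (\<lambda>t. G t * w t)"
    using t0 int by (intro Henstock_Kurzweil_Integration.integral_combine) auto
  finally show ?thesis .
qed

text \<open>Morally \<open>\<integral> G k = \<integral> K dG\<close> with \<open>K a = \<integral>\<^bsub>a\<^esub>\<^bsup>1\<^esup> k\<close>. Since \<open>G\<close> may blow up at \<open>1\<close>, the second mean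
  value theorem is applied on \<open>[0, b]\<close>; the error is controlled by \<open>\<integral>\<^bsub>b\<^esub>\<^bsup>1\<^esup> G\<close>.\<close>

lemma Bonnet_nonneg:
  fixes G k :: "real \<Rightarrow> real"
  assumes mono: "mono_on {0..<1} G" and G0: "G 0 = 0" and G1: "G 1 \<ge> 0"
    and int: "G integrable_on {0..1}"
    and k: "continuous_on {0..1} k"
    and K: "\<And>a. 0 \<le> a \<Longrightarrow> a \<le> 1 \<Longrightarrow> 0 \<le> integral {a..1} k"
  shows "0 \<le> integral {0..1} (\<lambda>t. G t * k t)"
proof -
  have nonneg: "0 \<le> G t" if "t \<in> {0..1}" for t
    using mono_onD[OF mono, of 0 t] that G0 G1 by (cases "t = 1") auto
  have intk: "k integrable_on {a..b}" if "0 \<le> a" "b \<le> 1" for a b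
    using that by (intro integrable_continuous_real continuous_on_subset[OF k]) auto
  obtain C where C: "\<And>t. t \<in> {0..1} \<Longrightarrow> \<bar>k t\<bar> \<le> C"
    using compact_imp_bounded[OF compact_continuous_image[OF k compact_Icc]]
    unfolding bounded_iff by (metis imageI real_norm_def)
  have Cpos: "0 \<le> C" using C[of 0] by auto
  have Gk: "(\<lambda>t. G t * k t) integrable_on {0..1}"
    using int nonneg k by (rule integrable_mult_continuous)
  have *: "- C * integral {b..1} G \<le> integral {0..b} (\<lambda>t. G t * k t)" if b: "0 \<le> b" "b < 1" for b
  proof -
    have intG: "G integrable_on {b..1}"
      using int by (rule integrable_on_subinterval) (use b in auto)
    have "k integrable_on {0..b}" using b by (intro intk) auto
    \<comment> \<open>Because \<open>G 0 = 0\<close>, only the term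
      \<open>G b * integral {c..b} k\<close> of the mean value formula survives.\<close>
    then obtain c where c: "c \<in> {0..b}"
      and hi: "((\<lambda>t. G t * k t) has_integral (G 0 * integral {0..c} k + G b * integral {c..b} k)) {0..b}"
      using second_mean_value_theorem_full[of k 0 b G] mono b by (force simp: mono_on_def)
    have split: "integral {c..b} k + integral {b..1} k = integral {c..1} k"
      using c b by (intro Henstock_Kurzweil_Integration.integral_combine intk) auto
    have "integral {b..1} k \<le> integral {b..1} (\<lambda>_. C)"
      using b C by (intro integral_le intk) (auto intro: order_trans[OF abs_ge_self])
    then have Kb: "integral {b..1} k \<le> C * (1 - b)" using b by (simp add: mult.commute)
    \<comment> \<open>Monotonicity trades the boundary value \<open>G b\<close>, which may be
      unbounded as b tends to 1, for the tail of a convergent integral.\<close>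
    have "integral {b..1} (\<lambda>_. G b) \<le> integral {b..1} G"
      by (rule integral_le_interior[OF _ intG]) (use b mono in \<open>auto intro: mono_onD\<close>)
    then have Gb: "G b * (1 - b) \<le> integral {b..1} G" using b by (simp add: mult.commute)
    have "- C * integral {b..1} G \<le> - C * (G b * (1 - b))"
      using Gb Cpos mult_left_mono by fastforce
    also have "\<dots> = G b * (0 - C * (1 - b))" by (simp add: algebra_simps)
    also have "\<dots> \<le> G b * (integral {c..1} k - integral {b..1} k)"
      using Kb K[of c] c b nonneg[of b] by (intro mult_left_mono) auto
    also have "\<dots> = integral {0..b} (\<lambda>t. G t * k t)"
      using split G0 by (simp add: integral_unique[OF hi] algebra_simps flip: split)
    finally show ?thesis .
  qed
  have "continuous_on {0..1} (\<lambda>b. integral {0..b} (\<lambda>t. G t * k t) + C * integral {b..1} G)"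
    by (intro continuous_intros indefinite_integral_continuous_1 indefinite_integral_continuous_1' Gk int)
  then have "((\<lambda>b. integral {0..b} (\<lambda>t. G t * k t) + C * integral {b..1} G)
       \<longlongrightarrow> integral {0..1} (\<lambda>t. G t * k t) + C * integral {1..1} G) (at 1 within {0..1})"
    unfolding continuous_on by (rule bspec) simp
  moreover have "at (1::real) within {0..1} = at_left 1"
    by (simp add: at_within_Icc_at_left)
  moreover have "\<forall>\<^sub>F b in at_left 1. 0 \<le> integral {0..b} (\<lambda>t. G t * k t) + C * integral {b..1} G"
    using eventually_at_left_real[OF zero_less_one]
  proof eventually_elim
    case (elim b)
    then show ?case using *[of b] by simp
  qed
  ultimately have "0 \<le> integral {0..1} (\<lambda>t. G t * k t) + C * integral {1..1} G"
    by (intro tendsto_lowerbound) auto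
  then show ?thesis by simp
qed

section \<open>Convex functions against a cosine over full periods\<close>

lemma convex_on_line_inside:
  fixes G :: "real \<Rightarrow> real"
  assumes "convex_on I G" "a \<in> I" "b \<in> I" "a \<le> t" "t \<le> b" "a < b"
  shows "G t \<le> G a + (G b - G a) / (b - a) * (t - a)"
proof (cases "t = a \<or> t = b")
  case True
  then show ?thesis using assms by auto
next
  case False
  then have "(G a - G t) / (a - t) \<le> (G a - G b) / (a - b)"
    using assms by (intro convex_on_slope_le) auto
  then have "(G t - G a) / (t - a) \<le> (G b - G a) / (b - a)"
    by (metis minus_diff_eq minus_divide_divide)
  then show ?thesis using False assms by (simp add: pos_divide_le_eq)
qed

lemma convex_on_line_outside:
  fixes G :: "real \<Rightarrow> real"
  assumes c: "convex_on I G" "a \<in> I" "b \<in> I" "t \<in> I" "a < b" and t: "t \<le> a \<or> b \<le> t"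
  shows "G a + (G b - G a) / (b - a) * (t - a) \<le> G t"
proof -
  consider "t < a" | "t = a" | "t = b" | "b < t" using t by linarith
  then show ?thesis
  proof cases
    case 1
    then have "(G t - G a) / (t - a) \<le> (G t - G b) / (t - b)" "(G t - G b) / (t - b) \<le> (G a - G b) / (a - b)"
      using convex_on_slope_le[of I G t b a] c by auto
    then have "(G t - G a) / (t - a) \<le> (G b - G a) / (b - a)"
      by (metis minus_diff_eq minus_divide_divide order_trans)
    then show ?thesis using 1 by (simp add: neg_divide_le_eq)
  next
    case 4
    then have "(G a - G b) / (a - b) \<le> (G a - G t) / (a - t)"
      using c by (intro convex_on_slope_le) auto
    then have "(G b - G a) / (b - a) \<le> (G t - G a) / (t - a)"
      by (metis minus_diff_eq minus_divide_divide)
    then show ?thesis using 4 c by (simp add: pos_le_divide_eq)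
  qed (use c in auto)
qed


lemma has_integral_deriv:
  fixes f :: "real \<Rightarrow> real"
  assumes "a \<le> b" "\<And>t. (f has_real_derivative f' t) (at t)"
  shows "(f' has_integral (f b - f a)) {a..b}"
  using assms(1)
proof (rule fundamental_theorem_of_calculus)
  fix t show "(f has_vector_derivative f' t) (at t within {a..b})"
    using assms(2) by (simp add: has_real_derivative_iff_has_vector_derivative has_vector_derivative_at_within)
qed

text \<open>The period starts at a peak of the cosine, so the sine vanishes at both ends and the
  slope leaves no boundary term; a general phase would leave a multiple of
  \<open>\<beta>\<close>.\<close>

lemma integral_linear_cos_period:
  fixes x c p \<alpha> \<beta> :: real
  assumes x: "x > 0" and p: "p = 2 * pi / x"
  shows "((\<lambda>t. (\<alpha> + \<beta> * (t - c)) * cos (x * (t - c))) has_integral 0) {c..c+p}"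
proof -
  define \<Phi> where "\<Phi> t = (\<alpha> + \<beta> * (t - c)) * sin (x * (t - c)) / x + \<beta> * cos (x * (t - c)) / x\<^sup>2" for t
  have "(\<Phi> has_real_derivative (\<alpha> + \<beta> * (t - c)) * cos (x * (t - c))) (at t)" for t
    unfolding \<Phi>_def
    by (rule derivative_eq_intros refl | use x in \<open>simp add: field_simps power2_eq_square\<close>)+
  then have "((\<lambda>t. (\<alpha> + \<beta> * (t - c)) * cos (x * (t - c))) has_integral (\<Phi> (c + p) - \<Phi> c)) {c..c+p}"
    using x p by (intro has_integral_deriv) auto
  moreover have "\<Phi> (c + p) - \<Phi> c = 0"
    using x by (simp add: \<Phi>_def p)
  ultimately show ?thesis by simp
qed

text \<open>The chord of \<open>G\<close> through the quarter points of the period lies above \<open>G\<close> exactly where the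
  cosine is negative, and the chord itself integrates to zero against the cosine.\<close>

lemma convex_cos_period_nonneg:
  fixes G :: "real \<Rightarrow> real"
  assumes G: "convex_on {0<..<1} G" and x: "x > 0" and p: "p = 2 * pi / x"
    and c: "0 \<le> c" "c + p \<le> 1"
    and int: "(\<lambda>t. G t * cos (x * (t - c))) integrable_on {c..c+p}"
  shows "0 \<le> integral {c..c+p} (\<lambda>t. G t * cos (x * (t - c)))"
proof -
  have p0: "p > 0" using x p by simp
  define a b where "a = c + p / 4" and "b = c + 3 * p / 4"
  define m where "m = (G b - G a) / (b - a)"
  have ab: "a \<in> {0<..<1}" "b \<in> {0<..<1}" "a < b"
    using p0 c by (auto simp: a_def b_def)
  define \<alpha> where "\<alpha> = G a - m * p / 4"
  have line: "\<alpha> + m * (t - c) = G a + m * (t - a)" for t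
    by (simp add: \<alpha>_def a_def algebra_simps)
  have L: "((\<lambda>t. (\<alpha> + m * (t - c)) * cos (x * (t - c))) has_integral 0) {c..c+p}"
    using x p by (rule integral_linear_cos_period)
  have xp: "x * p = 2 * pi" using x p by simp
  have "integral {c..c+p} (\<lambda>t. (\<alpha> + m * (t - c)) * cos (x * (t - c)))
      \<le> integral {c..c+p} (\<lambda>t. G t * cos (x * (t - c)))"
  proof (rule integral_le_interior[OF has_integral_integrable[OF L] int])
    fix t assume t: "c < t" "t < c + p"
    then have tI: "t \<in> {0<..<1}" using c by auto
    define u where "u = x * (t - c)"
    have u: "0 < u" "u < 2 * pi" 
      using t x mult_strict_left_mono[of "t - c" p x] xp by (auto simp: u_def)
    have ua: "u - pi / 2 = x * (t - a)" and ub: "u - 3 * pi / 2 = x * (t - b)"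
      using xp by (auto simp: u_def a_def b_def algebra_simps)
    consider "t < a" | "a \<le> t" "t \<le> b" | "b < t" by linarith
    then show "(\<alpha> + m * (t - c)) * cos (x * (t - c)) \<le> G t * cos (x * (t - c))"
    proof cases
      case 1
      then have "x * (t - a) < 0" using x by (simp add: mult_less_0_iff)
      then have "cos u \<ge> 0" using ua u by (intro cos_ge_zero) auto
      moreover have "G a + m * (t - a) \<le> G t"
        unfolding m_def using G ab tI 1 by (intro convex_on_line_outside) auto
      ultimately show ?thesis unfolding line u_def[symmetric] by (rule mult_right_mono[rotated])
    next
      case 2
      then have "x * (t - a) \<ge> 0" "x * (t - b) \<le> 0" using x by (auto simp: mult_le_0_iff)
      then have "- cos u \<ge> 0"
        using ua ub u cos_ge_zero[of "u - pi"] by auto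
      moreover have "G t \<le> G a + m * (t - a)"
        unfolding m_def using G ab 2 by (intro convex_on_line_inside) auto
      ultimately show ?thesis unfolding line u_def[symmetric] by (simp add: mult_right_mono_neg)
    next
      case 3
      then have "x * (t - b) > 0" using x by simp
      then have "cos u \<ge> 0"
        using ub u cos_ge_zero[of "u - 2 * pi"] by (auto simp: cos_diff)
      moreover have "G a + m * (t - a) \<le> G t"
        unfolding m_def using G ab tI 3 by (intro convex_on_line_outside) auto
      ultimately show ?thesis unfolding line u_def[symmetric] by (rule mult_right_mono[rotated])
    qed
  qed
  then show ?thesis using integral_unique[OF L] by simp
qed

lemma convex_cos_periods_nonneg:
  fixes G :: "real \<Rightarrow> real"
  assumes G: "convex_on {0<..<1} G" and x: "x > 0" and p: "p = 2 * pi / x"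
    and c: "0 \<le> c" "c + real j * p \<le> 1"
    and int: "(\<lambda>t. G t * cos (x * (t - c))) integrable_on {0..1}"
  shows "0 \<le> integral {c..c + real j * p} (\<lambda>t. G t * cos (x * (t - c)))"
  using c
proof (induction j)
  case (Suc j)
  have p0: "p > 0" using x p by simp
  define d where "d = c + real j * p"
  have d: "c \<le> d" "0 \<le> d" "d + p \<le> 1" "c + real (Suc j) * p = d + p"
    using Suc.prems p0 by (auto simp: d_def algebra_simps)
  have eq: "cos (x * (t - d)) = cos (x * (t - c))" for t
  proof -
    have "x * (t - d) = x * (t - c) - of_nat j * (2 * pi)"
      using x by (simp add: d_def p field_simps)
    then show ?thesis using cos.minus_of_nat[of "x * (t - c)" j] by simp
  qed
  have "0 \<le> integral {d..d+p} (\<lambda>t. G t * cos (x * (t - d)))"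
  proof (rule convex_cos_period_nonneg[OF G x p])
    show "(\<lambda>t. G t * cos (x * (t - d))) integrable_on {d..d+p}"
      unfolding eq using int by (rule integrable_on_subinterval) (use d in auto)
  qed (use d in auto)
  moreover have "0 \<le> integral {c..d} (\<lambda>t. G t * cos (x * (t - c)))"
    using Suc.IH Suc.prems d p0 by (simp add: d_def)
  moreover have "integral {c..d} (\<lambda>t. G t * cos (x * (t - c))) + integral {d..d+p} (\<lambda>t. G t * cos (x * (t - c)))
      = integral {c..d+p} (\<lambda>t. G t * cos (x * (t - c)))"
    using d p0 Suc.prems
    by (intro Henstock_Kurzweil_Integration.integral_combine integrable_on_subinterval[OF int]) auto
  ultimately show ?case unfolding d(4) by (simp add: eq)
qed simp


text \<open>Two upward crossings would enclose another zero that is not one: just after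
  \<open>y\<close> the function is positive, just before the next zero \<open>w\<close> it is
  negative, and the intermediate value theorem puts a zero before \<open>w\<close>.\<close>

lemma zero_unique_if_deriv_pos:
  fixes f f' :: "real \<Rightarrow> real"
  assumes der: "\<And>x. a < x \<Longrightarrow> x < b \<Longrightarrow> (f has_real_derivative f' x) (at x)"
    and pos: "\<And>x. a < x \<Longrightarrow> x < b \<Longrightarrow> f x = 0 \<Longrightarrow> f' x > 0"
    and z: "a < y" "z < b" "f y = 0" "f z = 0"
  shows "z \<le> y"
proof (rule ccontr)
  assume "\<not> z \<le> y"
  then have yz: "y < z" by simp
  obtain d where d: "d > 0" "\<And>h. 0 < h \<Longrightarrow> h < d \<Longrightarrow> f y < f (y + h)"
    using DERIV_pos_inc_right[of f "f' y" y] der[of y] pos[of y] z yz by auto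
  define u where "u = y + min d (z - y) / 2"
  have u: "y < u" "u < z" using d yz by (auto simp: u_def min_def field_simps)
  have "f u > 0" using d(2)[of "min d (z - y) / 2"] d(1) yz z by (auto simp: u_def min_def)
  have cont: "continuous_on {u..z} f"
    using der u z by (intro DERIV_continuous_on[where D = f']) (auto intro: has_field_derivative_at_within)
  \<comment> \<open>A next zero has to be shown to exist; the zero set is compact once a right
    neighbourhood of \<open>y\<close> is cut off.\<close>
  have "compact {x \<in> {u..z}. f x = 0}"
    using continuous_closed_preimage_constant[OF cont, of 0]
    by (auto simp: compact_eq_bounded_closed intro: bounded_subset[OF bounded_closed_interval])
  moreover have "z \<in> {x \<in> {u..z}. f x = 0}" using u z by auto
  ultimately obtain w where w: "u \<le> w" "w \<le> z" "f w = 0"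
    and least: "\<And>x. u \<le> x \<Longrightarrow> x \<le> z \<Longrightarrow> f x = 0 \<Longrightarrow> w \<le> x"
    using compact_attains_inf[of "{x \<in> {u..z}. f x = 0}"] by auto
  have "u < w" using w \<open>f u > 0\<close> by (cases "u = w") auto
  obtain e where e: "e > 0" "\<And>h. 0 < h \<Longrightarrow> h < e \<Longrightarrow> f (w - h) < f w"
    using DERIV_pos_inc_left[of f "f' w" w] der[of w] pos[of w] w z u by auto
  define v where "v = w - min e (w - u) / 2"
  have v: "u < v" "v < w" using e \<open>u < w\<close> by (auto simp: v_def min_def field_simps)
  have "f v < 0" using e(2)[of "min e (w - u) / 2"] e(1) \<open>u < w\<close> w by (auto simp: v_def min_def)
  then obtain x where "u \<le> x" "x \<le> v" "f x = 0"
    using IVT2'[of f v 0 u] \<open>f u > 0\<close> v w continuous_on_subset[OF cont, of "{u..v}"] by auto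
  then show False using least[of x] v w by auto
qed

section \<open>The transforms of G, their derivatives and the rotation to the endpoint 1\<close>

text \<open>\<open>G\<close> is -f' extended by 0. The value 0 at the origin extends monotonicity to
  \<open>{0..<1}\<close> and provides the start \<open>G 0 = 0\<close> for
  \<open>Bonnet_nonneg\<close>; at 1 it replaces a limit that may be infinite. \<open>M\<close> is a
  free parameter, so that the locale can be instantiated before the limit of f at 1 is
  known.\<close>

locale convex_density =
  fixes G :: "real \<Rightarrow> real" and M :: real
  assumes mono: "mono_on {0<..<1} G"
    and pos: "\<And>t. 0 < t \<Longrightarrow> t < 1 \<Longrightarrow> 0 < G t"
    and conv: "convex_on {0<..<1} G"
    and zero: "\<And>t. t \<le> 0 \<or> 1 \<le> t \<Longrightarrow> G t = 0"
    and int: "G integrable_on {0..1}"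
    and nonconst: "\<not> G constant_on {0<..<1}"
    and M_nonneg: "0 \<le> M"
begin

text \<open>This is f rebuilt from its derivative and its limit at 1; unlike f it has meaningful
  values at both endpoints.\<close>

definition F :: "real \<Rightarrow> real" where
  "F t = M + integral {0..1} G - integral {0..t} G"

definition U :: "real \<Rightarrow> real" where
  "U x = integral {0..1} (\<lambda>t. F t * cos (x * t))"

definition V :: "real \<Rightarrow> real" where
  "V x = M * sin x + integral {0..1} (\<lambda>t. G t * sin (x * t))"

definition V' :: "real \<Rightarrow> real" where
  "V' x = M * cos x + integral {0..1} (\<lambda>t. G t * (t * cos (x * t)))"

definition A :: "real \<Rightarrow> real" where
  "A x = integral {0..1} (\<lambda>t. G t * sin (x * (1 - t)))"

definition B :: "real \<Rightarrow> real" where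
  "B x = M + integral {0..1} (\<lambda>t. G t * cos (x * (1 - t)))"

lemma nonneg: "0 \<le> G t"
  using pos[of t] zero[of t] by linarith

lemma mono0: "mono_on {0..<1} G"
proof (rule mono_onI)
  fix s t assume "s \<in> {0..<1}" "t \<in> {0..<1}" "s \<le> (t::real)"
  then show "G s \<le> G t"
    using mono_onD[OF mono, of s t] nonneg zero by (cases "s = 0") auto
qed

lemma int_mult: "continuous_on {0..1} k \<Longrightarrow> (\<lambda>t. G t * k t) integrable_on {0..1}"
  using int nonneg by (rule integrable_mult_continuous)

lemma G_cont: "continuous_on {0<..<1} G"
  by (rule convex_on_continuous[OF _ conv]) simp

lemma F_cont: "continuous_on {0..1} F"
  unfolding F_def by (intro continuous_intros indefinite_integral_continuous_1 int)

lemma F_1 [simp]: "F 1 = M"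
  by (simp add: F_def)

lemma F_deriv:
  assumes t: "0 < t" "t < 1"
  shows "(F has_real_derivative - G t) (at t)"
proof -
  have "continuous (at t) G"
    using G_cont t by (simp add: continuous_on_eq_continuous_at)
  then have "((\<lambda>u. integral {0..u} G) has_vector_derivative G t) (at t within {0..1})"
    using integral_has_vector_derivative_continuous_at[OF int, of t "{}"] t
      continuous_at_imp_continuous_within by auto
  then have "((\<lambda>u. integral {0..u} G) has_real_derivative G t) (at t)"
    using t at_within_Icc_at[of 0 t 1] by (simp add: has_real_derivative_iff_has_vector_derivative)
  then show ?thesis
    unfolding F_def by (auto intro!: derivative_eq_intros)
qed

text \<open>\<open>F\<close> is continuous on \<open>{0..1}\<close> but its derivative is known only
  inside, hence the interior form of the fundamental theorem.\<close>

lemma by_parts: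
  assumes \<phi>: "\<And>t. (\<phi> has_real_derivative \<phi>' t) (at t)" and cont: "continuous_on {0..1} \<phi>'"
  shows "integral {0..1} (\<lambda>t. G t * \<phi> t) =
    F 0 * \<phi> 0 - M * \<phi> 1 + integral {0..1} (\<lambda>t. F t * \<phi>' t)"
proof -
  have c\<phi>: "continuous_on {0..1} \<phi>"
    using \<phi> by (intro DERIV_continuous_on) (auto intro: has_field_derivative_at_within)
  have "((\<lambda>t. F t * \<phi>' t - G t * \<phi> t) has_integral (F 1 * \<phi> 1 - F 0 * \<phi> 0)) {0..1}"
  proof (rule fundamental_theorem_of_calculus_interior)
    show "continuous_on {0..1} (\<lambda>t. F t * \<phi> t)"
      by (intro continuous_intros F_cont c\<phi>)
    fix t :: real assume "t \<in> {0<..<1}"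
    then have "((\<lambda>t. F t * \<phi> t) has_real_derivative - G t * \<phi> t + \<phi>' t * F t) (at t)"
      by (intro DERIV_mult F_deriv \<phi>) auto
    then show "((\<lambda>t. F t * \<phi> t) has_vector_derivative F t * \<phi>' t - G t * \<phi> t) (at t)"
      by (simp add: has_real_derivative_iff_has_vector_derivative algebra_simps)
  qed simp
  moreover have "integral {0..1} (\<lambda>t. F t * \<phi>' t - G t * \<phi> t) =
      integral {0..1} (\<lambda>t. F t * \<phi>' t) - integral {0..1} (\<lambda>t. G t * \<phi> t)"
    by (intro integral_diff integrable_continuous_real int_mult continuous_intros F_cont c\<phi> cont)
  ultimately show ?thesis by (simp add: integral_unique)
qed

lemma V_eq: "V x = x * U x"
proof -
  have "integral {0..1} (\<lambda>t. G t * sin (x * t)) =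
      F 0 * sin (x * 0) - M * sin (x * 1) + integral {0..1} (\<lambda>t. F t * (x * cos (x * t)))"
    by (rule by_parts) (auto intro!: derivative_eq_intros continuous_intros)
  moreover have "integral {0..1} (\<lambda>t. F t * (x * cos (x * t))) = x * U x"
    unfolding U_def by (subst integral_mult_right[symmetric]) (simp add: algebra_simps)
  ultimately show ?thesis by (simp add: V_def)
qed

text \<open>The Leibniz rule needs a jointly continuous integrand, which \<open>F\<close> provides
  and \<open>G\<close> does not.\<close>

lemma U_deriv: "(U has_real_derivative - integral {0..1} (\<lambda>t. F t * (t * sin (x * t)))) (at x)"
proof -
  have cF: "continuous_on (UNIV \<times> {0..1}) (\<lambda>p. F (snd p))"
    by (rule continuous_on_compose2[OF F_cont]) (auto intro: continuous_intros)
  have "((\<lambda>x. integral (cbox 0 1) (\<lambda>t. F t * cos (x * t))) has_real_derivative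
      integral (cbox 0 1) (\<lambda>t. - (F t * (t * sin (x * t))))) (at x within UNIV)"
  proof (rule leibniz_rule_field_derivative)
    show "continuous_on (UNIV \<times> cbox 0 1) (\<lambda>(x, t). - (F t * (t * sin (x * t))))"
      unfolding split_beta box_real by (intro continuous_intros cF)
  qed (auto intro!: derivative_eq_intros integrable_continuous_real continuous_intros F_cont
      simp: algebra_simps)
  then show ?thesis by (simp add: U_def[abs_def])
qed

text \<open>The product rule for \<open>x * U x\<close> gives integrals of \<open>F\<close>;
  integrating by parts with \<open>t * cos (x * t)\<close> turns them back into integrals of
  \<open>G\<close>.\<close>

lemma V_deriv: "(V has_real_derivative V' x) (at x)"
proof -
  let ?D = "\<lambda>x. - integral {0..1} (\<lambda>t. F t * (t * sin (x * t)))"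
  have "((\<lambda>x. x * U x) has_real_derivative U x + x * ?D x) (at x)"
    by (rule DERIV_cong[OF DERIV_mult[OF DERIV_ident U_deriv]]) simp
  moreover have "V = (\<lambda>x. x * U x)"
    using V_eq by auto
  moreover have "V' x = U x + x * ?D x"
  proof -
    have "integral {0..1} (\<lambda>t. G t * (t * cos (x * t))) =
        F 0 * (0 * cos (x * 0)) - M * (1 * cos (x * 1)) +
        integral {0..1} (\<lambda>t. F t * (cos (x * t) - x * (t * sin (x * t))))"
      by (rule by_parts) (auto intro!: derivative_eq_intros continuous_intros)
    also have "integral {0..1} (\<lambda>t. F t * (cos (x * t) - x * (t * sin (x * t)))) =
        integral {0..1} (\<lambda>t. F t * cos (x * t) - x * (F t * (t * sin (x * t))))"
      by (simp add: algebra_simps)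
    also have "\<dots> = U x - integral {0..1} (\<lambda>t. x * (F t * (t * sin (x * t))))"
      unfolding U_def
      by (intro integral_diff integrable_continuous_real continuous_intros F_cont)
    finally show ?thesis by (simp add: V'_def)
  qed
  ultimately show ?thesis by simp
qed

lemma V_decomp: "V x = B x * sin x - A x * cos x"
proof -
  have "integral {0..1} (\<lambda>t. G t * sin (x * t)) =
      integral {0..1} (\<lambda>t. G t * cos (x * (1 - t)) * sin x - G t * sin (x * (1 - t)) * cos x)"
  proof (rule integral_cong)
    fix t :: real
    have "sin (x * t) = sin (x - x * (1 - t))" by (simp add: algebra_simps)
    then have *: "sin (x * t) = sin x * cos (x * (1 - t)) - cos x * sin (x * (1 - t))"
      by (simp add: sin_diff)
    show "G t * sin (x * t) = G t * cos (x * (1 - t)) * sin x - G t * sin (x * (1 - t)) * cos x"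
      unfolding * by algebra
  qed
  also have "\<dots> = (B x - M) * sin x - A x * cos x"
    unfolding A_def B_def by (subst integral_diff)
      (auto intro!: int_mult integrable_on_mult_left continuous_intros)
  finally show ?thesis by (simp add: V_def algebra_simps)
qed

lemma V'_decomp:
  "V' x = (B x - integral {0..1} (\<lambda>t. G t * ((1 - t) * cos (x * (1 - t))))) * cos x +
    (A x - integral {0..1} (\<lambda>t. G t * ((1 - t) * sin (x * (1 - t))))) * sin x"
proof -
  have "integral {0..1} (\<lambda>t. G t * (t * cos (x * t))) =
      integral {0..1} (\<lambda>t.
        (G t * cos (x * (1 - t)) - G t * ((1 - t) * cos (x * (1 - t)))) * cos x +
        (G t * sin (x * (1 - t)) - G t * ((1 - t) * sin (x * (1 - t)))) * sin x)"
  proof (rule integral_cong)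
    fix t :: real
    have "cos (x * t) = cos (x - x * (1 - t))" by (simp add: algebra_simps)
    then have *: "cos (x * t) = cos (x * (1 - t)) * cos x + sin (x * (1 - t)) * sin x"
      by (simp add: cos_diff)
    show "G t * (t * cos (x * t)) =
        (G t * cos (x * (1 - t)) - G t * ((1 - t) * cos (x * (1 - t)))) * cos x +
        (G t * sin (x * (1 - t)) - G t * ((1 - t) * sin (x * (1 - t)))) * sin x"
      unfolding * by algebra
  qed
  also have "\<dots> = (B x - M - integral {0..1} (\<lambda>t. G t * ((1 - t) * cos (x * (1 - t))))) * cos x +
    (A x - integral {0..1} (\<lambda>t. G t * ((1 - t) * sin (x * (1 - t))))) * sin x"
    unfolding A_def B_def
    by (subst integral_add integral_diff integral_mult_left |
        intro int_mult integrable_on_mult_left integrable_diff continuous_intros)+ simp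
  finally show ?thesis by (simp add: V'_def algebra_simps)
qed

end


section \<open>Positivity of A and the sign of V' at a zero\<close>

lemma sin_less_self:
  fixes y :: real
  assumes "0 < y"
  shows "sin y < y"
proof (cases "y \<le> 1")
  case True
  have "sin y < y \<longleftrightarrow> 0 < y - sin y" by simp
  moreover have "0 - sin 0 < y - sin y"
    using assms
  proof (rule DERIV_pos_imp_increasing_open)
    fix x assume x: "0 < x" "x < y"
    have "cos x < cos 0"
      using x True pi_gt3 by (intro cos_monotone_0_pi) auto
    then show "\<exists>d. ((\<lambda>y. y - sin y) has_real_derivative d) (at x) \<and> 0 < d"
      by (intro exI[of _ "1 - cos x"]) (auto intro!: derivative_eq_intros)
  qed (intro continuous_intros)
  ultimately show ?thesis by simp
next
  case False
  then show ?thesis using sin_le_one[of y] by linarith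
qed

context convex_density
begin

text \<open>Slopes of a convex function increase: the chord over \<open>{b..c}\<close> is no steeper
  than the one over \<open>{b..s}\<close>, which is no steeper than the one over
  \<open>{s..t}\<close>. Hence a hinge of the first slope, starting at \<open>c\<close>, can be
  subtracted from \<open>G\<close> without losing monotonicity.\<close>

lemma slope_ge:
  assumes "0 < b" "b < c" "c \<le> s" "s \<le> t" "t < 1"
  shows "(G c - G b) / (c - b) * (t - s) \<le> G t - G s"
proof -
  define m where "m = (G s - G b) / (s - b)"
  have "G b + (G c - G b) / (c - b) * (s - b) \<le> G s"
    using assms by (intro convex_on_line_outside[OF conv]) auto
  then have "(G c - G b) / (c - b) \<le> m"
    using assms by (simp add: m_def pos_le_divide_eq)
  then have "(G c - G b) / (c - b) * (t - s) \<le> m * (t - s)"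
    using assms by (intro mult_right_mono) auto
  moreover have "G b + m * (t - b) \<le> G t"
    unfolding m_def using assms by (intro convex_on_line_outside[OF conv]) auto
  moreover have "m * (s - b) = G s - G b"
    using assms by (simp add: m_def)
  ultimately show ?thesis by (simp add: algebra_simps)
qed

lemma ex_increase: obtains b c where "0 < b" "b < c" "c < 1" "G b < G c"
proof -
  obtain b c where bc: "b \<in> {0<..<1}" "c \<in> {0<..<1}" "G b \<noteq> G c"
    using nonconst unfolding constant_on_def by metis
  show thesis
  proof (cases "b < c")
    case True
    then show ?thesis using that[of b c] bc mono_onD[OF mono, of b c] by auto
  next
    case False
    then show ?thesis using that[of c b] bc mono_onD[OF mono, of c b] by (cases "b = c") auto
  qed
qed

text \<open>The integral equals (y - sin y) / x^2 with y = x (1 - c).\<close>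

lemma integral_hinge_sin_pos:
  assumes x: "0 < x" and c: "0 < c" "c < 1"
  shows "0 < integral {0..1} (\<lambda>t::real. max 0 (t - c) * sin (x * (1 - t)))"
proof -
  let ?h = "\<lambda>t::real. max 0 (t - c) * sin (x * (1 - t))"
  define \<Phi> where "\<Phi> t = (t - c) * cos (x * (1 - t)) / x + sin (x * (1 - t)) / x\<^sup>2" for t :: real
  have "(\<Phi> has_real_derivative (t - c) * sin (x * (1 - t))) (at t)" for t
    unfolding \<Phi>_def
    by (rule derivative_eq_intros refl | use x in \<open>simp add: field_simps power2_eq_square\<close>)+
  then have "((\<lambda>t. (t - c) * sin (x * (1 - t))) has_integral (\<Phi> 1 - \<Phi> c)) {c..1}"
    using c by (intro has_integral_deriv) auto
  then have "integral {c..1} (\<lambda>t. (t - c) * sin (x * (1 - t))) = \<Phi> 1 - \<Phi> c"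
    by (rule integral_unique)
  moreover have "integral {c..1} ?h = integral {c..1} (\<lambda>t. (t - c) * sin (x * (1 - t)))"
    by (rule integral_cong) auto
  moreover have "integral {0..c} ?h = integral {0..c} (\<lambda>t. 0)"
    by (rule integral_cong) auto
  moreover have "integral {0..c} ?h + integral {c..1} ?h = integral {0..1} ?h"
    using c by (intro Henstock_Kurzweil_Integration.integral_combine
        integrable_continuous_real continuous_intros) auto
  moreover have "\<Phi> 1 - \<Phi> c = (x * (1 - c) - sin (x * (1 - c))) / x\<^sup>2"
    using x by (simp add: \<Phi>_def field_simps power2_eq_square)
  moreover have "0 < (x * (1 - c) - sin (x * (1 - c))) / x\<^sup>2"
    using x c by (intro divide_pos_pos) (auto simp: sin_less_self)
  ultimately show ?thesis by simp
qed

text \<open>Subtracting a small hinge \<open>\<epsilon> max 0 (t - c)\<close> keeps \<open>G\<close> increasing, and the hinge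
  itself contributes strictly.\<close>

lemma A_pos:
  assumes x: "0 < x"
  shows "0 < A x"
proof -
  obtain b c where bc: "0 < b" "b < c" "c < 1" "G b < G c" by (rule ex_increase)
  define \<epsilon> where "\<epsilon> = (G c - G b) / (c - b)"
  have \<epsilon>: "0 < \<epsilon>" using bc by (simp add: \<epsilon>_def)
  \<comment> \<open>At 1, where \<open>G\<close> is 0, the difference would be negative; the value
    is reset because \<open>Bonnet_nonneg\<close> asks for \<open>0 \<le> H 1\<close>.\<close>
  define H where "H t = (if t < 1 then G t - \<epsilon> * max 0 (t - c) else 0)" for t :: real
  let ?k = "\<lambda>t. sin (x * (1 - t))"
  let ?h = "\<lambda>t. \<epsilon> * (max 0 (t - c) * ?k t)"
  have inth: "?h integrable_on {0..1}"
    by (intro integrable_continuous_real continuous_intros)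
  have "0 \<le> integral {0..1} (\<lambda>t. H t * ?k t)"
  proof (rule Bonnet_nonneg)
    show "mono_on {0..<1} H"
    proof (rule mono_onI)
      fix s t :: real assume st: "s \<in> {0..<1}" "t \<in> {0..<1}" "s \<le> t"
      then have le: "G s \<le> G t" by (intro mono_onD[OF mono0])
      consider "t \<le> c" | "s \<le> c" "c \<le> t" | "c \<le> s" by linarith
      then show "H s \<le> H t"
      proof cases
        case 1
        then show ?thesis using st le by (simp add: H_def)
      next
        case 2
        have "\<epsilon> * (t - c) \<le> G t - G c"
          unfolding \<epsilon>_def using bc st 2 by (intro slope_ge) auto
        moreover have "G s \<le> G c"
          using st bc 2 by (intro mono_onD[OF mono0]) auto
        ultimately show ?thesis using st 2 by (simp add: H_def)
      next
        case 3
        have "\<epsilon> * (t - s) \<le> G t - G s"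
          unfolding \<epsilon>_def using bc st 3 by (intro slope_ge) auto
        then show ?thesis using st 3 by (simp add: H_def algebra_simps)
      qed
    qed
    show "H 0 = 0" using bc zero by (simp add: H_def)
    show "0 \<le> H 1" by (simp add: H_def)
    have "(\<lambda>t. G t - \<epsilon> * max 0 (t - c)) integrable_on {0..1}"
      by (intro integrable_diff int integrable_continuous_real continuous_intros)
    then show "H integrable_on {0..1}"
      unfolding integrable_on_Icc_iff_Ioo by (rule integrable_eq) (auto simp: H_def)
    show "continuous_on {0..1} ?k" by (intro continuous_intros)
    \<comment> \<open>The tail integral is (1 - cos (x (1 - a))) / x.\<close>
    fix a :: real assume a: "0 \<le> a" "a \<le> 1"
    have "(?k has_integral (cos (x * (1 - 1)) / x - cos (x * (1 - a)) / x)) {a..1}"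
      using a x by (intro has_integral_deriv) (auto intro!: derivative_eq_intros)
    then show "0 \<le> integral {a..1} ?k"
      using x by (simp add: integral_unique flip: diff_divide_distrib)
  qed
  also have "integral {0..1} (\<lambda>t. H t * ?k t) = integral {0..1} (\<lambda>t. G t * ?k t - ?h t)"
    unfolding integral_open_interval_real by (rule integral_cong) (auto simp: H_def algebra_simps)
  also have "\<dots> = A x - \<epsilon> * integral {0..1} (\<lambda>t. max 0 (t - c) * ?k t)"
    unfolding A_def by (subst integral_diff) (auto intro!: int_mult inth continuous_intros)
  finally show ?thesis
    using mult_pos_pos[OF \<epsilon> integral_hinge_sin_pos[OF x, of c]] bc by simp
qed

text \<open>Bonnet's inequality for a one-parameter family of kernels whose tail integrals are
  \<open>(1 - (1 - p) cos \<alpha> - p cos (\<alpha> - \<phi>)) / x\<close> with \<open>\<alpha> = x p\<close>, \<open>0 \<le> p \<le> 1\<close>; the best choice of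
  \<open>\<phi>\<close> gives \<open>sqrt (P\<^sup>2 + Q\<^sup>2) \<le> A + P\<close>.\<close>

lemma tangent_inequality:
  fixes x :: real
  assumes x: "0 < x"
  defines "A1 \<equiv> integral {0..1} (\<lambda>t. G t * ((1 - t) * sin (x * (1 - t))))"
    and "B1 \<equiv> integral {0..1} (\<lambda>t. G t * ((1 - t) * cos (x * (1 - t))))"
  defines "P \<equiv> (B x - M) / x - A1" and "Q \<equiv> B1 + A x / x"
  shows "P * cos \<phi> + Q * sin \<phi> \<le> A x + P"
proof -
  \<comment> \<open>\<open>k\<close> collects what multiplies \<open>G\<close> in
    \<open>A x + P * (1 - cos \<phi>) - Q * sin \<phi>\<close>; \<open>\<Psi>\<close> is its
    antiderivative vanishing at 1.\<close>
  define k where "k t = cos (x * (1 - t)) / x + t * sin (x * (1 - t))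
    - cos (x * (1 - t) - \<phi>) / x + (1 - t) * sin (x * (1 - t) - \<phi>)" for t
  define \<Psi> where "\<Psi> t = - (1 - t * cos (x * (1 - t)) - (1 - t) * cos (x * (1 - t) - \<phi>)) / x" for t
  have d\<Psi>: "(\<Psi> has_real_derivative k t) (at t)" for t
    unfolding \<Psi>_def k_def
    by (rule derivative_eq_intros refl | use x in \<open>simp add: field_simps\<close>)+
  have "0 \<le> integral {0..1} (\<lambda>t. G t * k t)"
  proof (rule Bonnet_nonneg[OF mono0 _ _ int])
    show "continuous_on {0..1} k" unfolding k_def by (intro continuous_intros) (use x in auto)
    fix a :: real assume a: "0 \<le> a" "a \<le> 1"
    \<comment> \<open>The weights \<open>a\<close> and \<open>1 - a\<close> form a convex
      combination of two cosines, which is at most 1.\<close>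
    have "a * cos (x * (1 - a)) \<le> a * 1" "(1 - a) * cos (x * (1 - a) - \<phi>) \<le> (1 - a) * 1"
      using a by (intro mult_left_mono cos_le_one; simp)+
    then have "\<Psi> a \<le> 0" using x by (simp add: \<Psi>_def divide_nonpos_pos)
    moreover have "integral {a..1} k = \<Psi> 1 - \<Psi> a"
      using a by (intro integral_unique has_integral_deriv d\<Psi>)
    ultimately show "0 \<le> integral {a..1} k" by (simp add: \<Psi>_def)
  qed (auto simp: zero)
  also have "(\<lambda>t. G t * k t) = (\<lambda>t. G t * sin (x * (1 - t))
    + (G t * cos (x * (1 - t)) / x - G t * ((1 - t) * sin (x * (1 - t)))) * (1 - cos \<phi>)
    - (G t * ((1 - t) * cos (x * (1 - t))) + G t * sin (x * (1 - t)) / x) * sin \<phi>)"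
    unfolding k_def cos_diff[of _ \<phi>] sin_diff[of _ \<phi>] using x by (simp add: field_simps)
  also have "integral {0..1} \<dots> = A x + P * (1 - cos \<phi>) - Q * sin \<phi>"
    unfolding A1_def B1_def P_def Q_def A_def B_def
    by (subst integral_add integral_diff integral_mult_left integral_divide |
        intro int_mult integrable_on_mult_left integrable_diff integrable_add
          integrable_on_divide continuous_intros)+ simp
  finally show ?thesis by (simp add: algebra_simps)
qed

text \<open>At a zero, (A, B) = C (sin x, cos x). Since C sin x = A > 0, the sign of V' sin x is
  that of V' C, and V' C is a quadratic expression in A, B and the weighted integrals
  \<open>A1\<close>, \<open>B1\<close>, free of sin x and cos x.\<close>

lemma zero_deriv_sign:
  assumes x: "0 < x" and V: "V x = 0"
  shows "0 < V' x * sin x"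
proof -
  define A1 where "A1 = integral {0..1} (\<lambda>t. G t * ((1 - t) * sin (x * (1 - t))))"
  define B1 where "B1 = integral {0..1} (\<lambda>t. G t * ((1 - t) * cos (x * (1 - t))))"
  \<comment> \<open>Since A' = \<open>B1\<close> and B' = -\<open>A1\<close>, these are (x (B - M))'
    / x and (x A)' / x. With them the mixed terms A B / x cancel in V' C.\<close>
  define P where "P = (B x - M) / x - A1"
  define Q where "Q = B1 + A x / x"
  define C where "C = B x * cos x + A x * sin x"
  have A: "0 < A x" using x by (rule A_pos)
  have BA: "B x * sin x = A x * cos x" using V V_decomp by simp
  have sc: "(sin x)\<^sup>2 + (cos x)\<^sup>2 = 1" by simp
  have Cs: "C * sin x = A x" using BA sc unfolding C_def power2_eq_square by algebra
  have Cc: "C * cos x = B x" using BA sc unfolding C_def power2_eq_square by algebra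
  have "C\<^sup>2 = (C * sin x)\<^sup>2 + (C * cos x)\<^sup>2"
    by (simp add: power_mult_distrib flip: distrib_left)
  then have C2: "C\<^sup>2 = (A x)\<^sup>2 + (B x)\<^sup>2" by (simp only: Cs Cc)
  have PQ: "P\<^sup>2 + Q\<^sup>2 \<le> (A x + P)\<^sup>2"
  proof -
    \<comment> \<open>Taking \<open>\<phi>\<close> as the direction of (P, Q) makes the left side of
      \<open>tangent_inequality\<close> equal to the length of that vector.\<close>
    obtain r \<phi> where r: "P = r * cos \<phi>" "Q = r * sin \<phi>" "0 \<le> r"
    proof (cases "P\<^sup>2 + Q\<^sup>2 = 0")
      case True
      then have "P = 0 \<and> Q = 0" by (simp add: sum_power2_eq_zero_iff)
      then show ?thesis using that[of 0 0] by simp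
    next
      case False
      then have "sqrt (P\<^sup>2 + Q\<^sup>2) \<noteq> 0" by simp
      then have "(P / sqrt (P\<^sup>2 + Q\<^sup>2))\<^sup>2 + (Q / sqrt (P\<^sup>2 + Q\<^sup>2))\<^sup>2 = 1"
        using False by (simp add: power_divide flip: add_divide_distrib)
      then obtain \<phi> where "P / sqrt (P\<^sup>2 + Q\<^sup>2) = cos \<phi>" "Q / sqrt (P\<^sup>2 + Q\<^sup>2) = sin \<phi>"
        using sincos_total_2pi by metis
      then show ?thesis
        using that[of "sqrt (P\<^sup>2 + Q\<^sup>2)" \<phi>] False by (simp add: field_simps)
    qed
    have "r = P * cos \<phi> + Q * sin \<phi>"
      using r sin_cos_squared_add[of \<phi>] unfolding power2_eq_square by algebra
    also have "\<dots> \<le> A x + P"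
      using tangent_inequality[OF x, of \<phi>] by (simp add: P_def Q_def A1_def B1_def)
    finally have "r\<^sup>2 \<le> (A x + P)\<^sup>2" using r(3) by (rule power_mono)
    moreover have "P\<^sup>2 + Q\<^sup>2 = r\<^sup>2"
      using r sin_cos_squared_add[of \<phi>] unfolding power2_eq_square by algebra
    ultimately show ?thesis by simp
  qed
  have "V' x = C - (B1 * cos x + A1 * sin x)"
    unfolding V'_decomp A1_def B1_def C_def by (simp add: algebra_simps)
  then have "V' x * C = C\<^sup>2 - (B1 * (C * cos x) + A1 * (C * sin x))"
    unfolding power2_eq_square by algebra
  also have "\<dots> = (A x)\<^sup>2 + (B x)\<^sup>2 - (B1 * B x + A1 * A x)"
    by (simp only: Cs Cc C2)
  also have "B1 * B x + A1 * A x = Q * B x - P * A x - A x * M / x"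
    using x by (simp add: P_def Q_def field_simps)
  \<comment> \<open>Completing the square in B - Q isolates (A + P)^2 - (P^2 + Q^2); every summand
    is then nonnegative and the first one positive.\<close>
  also have "(A x)\<^sup>2 + (B x)\<^sup>2 - (Q * B x - P * A x - A x * M / x) =
      ((A x)\<^sup>2 + (B x)\<^sup>2) / 2 + ((A x + P)\<^sup>2 - (P\<^sup>2 + Q\<^sup>2)) / 2 + (B x - Q)\<^sup>2 / 2 + A x * M / x"
    using x by (simp add: power2_eq_square field_simps)
  finally have eq: "V' x * C = ((A x)\<^sup>2 + (B x)\<^sup>2) / 2 + ((A x + P)\<^sup>2 - (P\<^sup>2 + Q\<^sup>2)) / 2
      + (B x - Q)\<^sup>2 / 2 + A x * M / x" .
  have "0 < (A x)\<^sup>2 + (B x)\<^sup>2" using A by (intro add_pos_nonneg) auto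
  then have "0 < V' x * C"
    unfolding eq using A M_nonneg x PQ by (intro add_pos_nonneg) auto
  moreover have "0 < C * sin x" using Cs A by simp
  ultimately have "0 < (V' x * C) * (C * sin x)" by (rule mult_pos_pos)
  also have "\<dots> = C\<^sup>2 * (V' x * sin x)" by (simp add: power2_eq_square)
  finally show ?thesis by (simp add: zero_less_mult_iff)
qed

end


section \<open>Signs of V on (0, pi] and at the midpoints (k + 1/2) pi\<close>

lemma sin_cos_three_halves_pi: "sin (3 * pi / 2) = -1" "cos (3 * pi / 2) = 0"
  using sin_3over2_pi cos_3over2_pi by simp_all

lemma minus_one_power_sandwich: "(-1) ^ k * (a * (-1) ^ k) = (a :: real)"
  by (cases "even k") auto

context convex_density
begin

lemma V_pos:
  assumes x: "0 < x" "x \<le> pi"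
  shows "0 < V x"
proof -
  have "0 < integral {0..1} (\<lambda>t. G t * sin (x * t))"
  proof (rule integral_mult_pos[OF mono])
    fix t :: real assume t: "0 < t" "t < 1"
    have "x * t < x * 1" using x t by (intro mult_strict_left_mono) auto
    then have "x * t < pi" using x by linarith
    then show "0 < sin (x * t)" using x t by (intro sin_gt_zero) auto
  qed (use pos[of "1/2"] in \<open>auto intro!: nonneg int_mult continuous_intros\<close>)
  moreover have "0 \<le> M * sin x"
    using x M_nonneg sin_ge_zero by simp
  ultimately show ?thesis by (simp add: V_def)
qed

text \<open>The point \<open>c\<close> is a peak of the cosine with whole periods after it. The head
  \<open>{0..c}\<close> left over is a quarter period in \<open>V_at_quarter\<close> and three
  quarters of one in \<open>V_at_three_quarters\<close>.\<close>

lemma tail_nonneg: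
  assumes x: "0 < x" and c: "0 \<le> c" "c + real j * (2 * pi / x) = 1"
  shows "0 \<le> integral {c..1} (\<lambda>t. G t * cos (x * (t - c)))"
proof -
  have "0 \<le> integral {c..c + real j * (2 * pi / x)} (\<lambda>t. G t * cos (x * (t - c)))"
    using c by (intro convex_cos_periods_nonneg[OF conv x refl] int_mult continuous_intros) auto
  then show ?thesis unfolding c(2) .
qed

text \<open>The sine is positive on the head, and after \<open>c\<close> it coincides with the
  cosine of \<open>tail_nonneg\<close>. As sin x = 1, the term with \<open>M\<close> also has the
  right sign, whatever L is.\<close>

lemma V_at_quarter:
  assumes x: "x = (2 * real j + 1/2) * pi"
  shows "0 < V x"
proof -
  have x0: "0 < x" using x by simp
  define c where "c = pi / (2 * x)"
  have xc: "x * c = pi / 2" using x0 by (simp add: c_def)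
  have c: "0 < c" "c + real j * (2 * pi / x) = 1"
  proof -
    have "c + real j * (2 * pi / x) = (pi / 2 + 2 * real j * pi) / x"
      by (simp add: c_def add_divide_distrib)
    also have "pi / 2 + 2 * real j * pi = x"
      unfolding x by (simp add: algebra_simps)
    finally show "c + real j * (2 * pi / x) = 1" using x0 by simp
  qed (use x0 in \<open>simp add: c_def\<close>)
  moreover have "0 \<le> real j * (2 * pi / x)" using x0 by simp
  ultimately have c1: "c \<le> 1" by linarith
  have int: "(\<lambda>t. G t * sin (x * t)) integrable_on {0..1}"
    by (intro int_mult continuous_intros)
  have "0 < integral {0..c} (\<lambda>t. G t * sin (x * t))"
  proof (rule integral_mult_pos)
    show "mono_on {0<..<c} G" using mono by (rule mono_on_subset) (use c1 in auto)
    show "(\<lambda>t. G t * sin (x * t)) integrable_on {0..c}"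
      using int by (rule integrable_on_subinterval) (use c1 in auto)
    fix t :: real assume t: "0 < t" "t < c"
    have "x * t < x * c" using x0 t by (intro mult_strict_left_mono) auto
    then have "x * t < pi" using xc pi_gt_zero by linarith
    then show "0 < sin (x * t)" using x0 t by (intro sin_gt_zero) auto
  qed (use c c1 pos[of "c/2"] in \<open>auto intro!: nonneg continuous_intros\<close>)
  moreover have "0 \<le> integral {c..1} (\<lambda>t. G t * cos (x * (t - c)))"
    using x0 c by (intro tail_nonneg) auto
  moreover have "cos (x * (t - c)) = sin (x * t)" for t
    by (simp add: right_diff_distrib xc cos_diff)
  moreover have "integral {0..c} (\<lambda>t. G t * sin (x * t)) + integral {c..1} (\<lambda>t. G t * sin (x * t))
      = integral {0..1} (\<lambda>t. G t * sin (x * t))"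
    using c c1 int by (intro Henstock_Kurzweil_Integration.integral_combine) auto
  moreover have "x = pi / 2 + of_nat j * (2 * pi)"
    unfolding x by (simp add: algebra_simps)
  then have "sin x = 1"
    using sin.plus_of_nat[of "pi / 2" j] by simp
  ultimately show ?thesis using M_nonneg by (simp add: V_def)
qed

lemma limit_le:
  assumes "(G \<longlongrightarrow> L) (at_right 0)" "0 < t" "t < 1"
  shows "L \<le> G t"
proof (rule tendsto_upperbound[OF assms(1)])
  show "\<forall>\<^sub>F s in at_right 0. G s \<le> G t"
    using eventually_at_right_real[OF assms(2)]
    by eventually_elim (use assms in \<open>auto intro: mono_onD[OF mono]\<close>)
qed simp

text \<open>The chord from s to \<open>e\<close> is followed as s tends to 0 from the right;
  \<open>L\<close> takes the place of the value at the origin, since \<open>G 0\<close> is 0 by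
  convention.\<close>

lemma limit_line_le:
  assumes L: "(G \<longlongrightarrow> L) (at_right 0)" and t: "0 < t" "t \<le> e" "e < 1"
  shows "G t \<le> L + (G e - L) / e * t"
proof (rule tendsto_lowerbound)
  show "((\<lambda>s. G s + (G e - G s) / (e - s) * (t - s)) \<longlongrightarrow> L + (G e - L) / e * t) (at_right 0)"
    using t by (auto intro!: tendsto_eq_intros L)
  show "\<forall>\<^sub>F s in at_right 0. G t \<le> G s + (G e - G s) / (e - s) * (t - s)"
    using eventually_at_right_real[OF t(1)]
    by eventually_elim (rule convex_on_line_inside[OF conv]; use t in auto)
qed simp

lemma limit_line_ge:
  assumes L: "(G \<longlongrightarrow> L) (at_right 0)" and e: "0 < e" "e \<le> t" "t < 1"
  shows "L + (G e - L) / e * t \<le> G t"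
proof (rule tendsto_upperbound)
  show "((\<lambda>s. G s + (G e - G s) / (e - s) * (t - s)) \<longlongrightarrow> L + (G e - L) / e * t) (at_right 0)"
    using e by (auto intro!: tendsto_eq_intros L)
  show "\<forall>\<^sub>F s in at_right 0. G s + (G e - G s) / (e - s) * (t - s) \<le> G t"
    using eventually_at_right_real[OF e(1)]
    by eventually_elim (rule convex_on_line_outside[OF conv]; use e in auto)
qed simp

text \<open>On the initial three quarters of a period, \<open>G\<close> is compared with the line through
  \<open>(0, L)\<close> that meets it where the sine changes sign.\<close>

lemma head_integral_le:
  assumes L: "(G \<longlongrightarrow> L) (at_right 0)" and x: "0 < x" and c: "x * c = 3 * pi / 2" "c \<le> 1"
    and e: "x * e = pi"
  shows "integral {0..c} (\<lambda>t. G t * sin (x * t)) \<le> L / x - (G e - L) / e / x\<^sup>2"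
proof -
  define m where "m = (G e - L) / e"
  have e0: "0 < e" using e x by (metis pi_gt_zero zero_less_mult_pos)
  have "x * e < x * c" using e c pi_gt_zero by linarith
  then have ec: "e < c" using x by simp
  have "((\<lambda>t. (L + m * t) * sin (x * t)) has_integral
      (- ((L + m * c) * cos (x * c)) / x + m * sin (x * c) / x\<^sup>2)
      - (- ((L + m * 0) * cos (x * 0)) / x + m * sin (x * 0) / x\<^sup>2)) {0..c}"
  proof (rule has_integral_deriv)
    fix t
    show "((\<lambda>t. - ((L + m * t) * cos (x * t)) / x + m * sin (x * t) / x\<^sup>2)
        has_real_derivative (L + m * t) * sin (x * t)) (at t)"
      by (rule derivative_eq_intros refl | use x in \<open>simp add: field_simps power2_eq_square\<close>)+
  qed (use e0 ec in simp)
  \<comment> \<open>At \<open>c\<close> the cosine is 0 and the sine is -1, so L / x comes from the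
    lower end and -m / x^2 from the upper one.\<close>
  then have I: "((\<lambda>t. (L + m * t) * sin (x * t)) has_integral L / x - m / x\<^sup>2) {0..c}"
    unfolding c(1) by (simp add: sin_cos_three_halves_pi)
  have "integral {0..c} (\<lambda>t. G t * sin (x * t)) \<le> integral {0..c} (\<lambda>t. (L + m * t) * sin (x * t))"
  proof (rule integral_le_interior[OF _ has_integral_integrable[OF I]])
    have "(\<lambda>t. G t * sin (x * t)) integrable_on {0..1}"
      by (intro int_mult continuous_intros)
    then show "(\<lambda>t. G t * sin (x * t)) integrable_on {0..c}"
      by (rule integrable_on_subinterval) (use c in auto)
    fix t :: real assume t: "0 < t" "t < c"
    have xt: "0 < x * t" "x * t < 3 * pi / 2" using t x by (auto simp: c(1)[symmetric])
    show "G t * sin (x * t) \<le> (L + m * t) * sin (x * t)"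
    proof (cases "t \<le> e")
      case True
      then have "x * t \<le> pi" using x by (simp add: e[symmetric])
      then have "0 \<le> sin (x * t)" using xt by (intro sin_ge_zero) auto
      moreover have "G t \<le> L + m * t"
        unfolding m_def using t True ec c by (intro limit_line_le[OF L]) auto
      ultimately show ?thesis by (simp add: mult_right_mono)
    next
      case False
      then have "pi \<le> x * t" using x by (simp add: e[symmetric])
      then have "sin (x * t) \<le> 0" using xt by (intro sin_le_zero) auto
      moreover have "L + m * t \<le> G t"
        unfolding m_def using t False e0 c by (intro limit_line_ge[OF L]) auto
      ultimately show ?thesis by (simp add: mult_right_mono_neg)
    qed
  qed
  then show ?thesis using integral_unique[OF I] by (simp add: m_def)
qed

text \<open>This settles the borderline 2 L = 3 pi M, where the bound of
  \<open>head_integral_le\<close> gives only \<open>V x \<le> 0\<close>. Convexity and monotonicity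
  force \<open>G\<close> to equal \<open>L\<close> up to 2/3 = pi / x; being nonconstant, it exceeds
  \<open>L\<close> later, where the sine is negative. The constant \<open>L\<close> itself
  integrates to L / x.\<close>

lemma head_integral_less:
  assumes L: "(G \<longlongrightarrow> L) (at_right 0)" and x: "x = 3 * pi / 2" and G: "G (2/3) = L"
  shows "integral {0..1} (\<lambda>t. G t * sin (x * t)) < L / x"
proof -
  let ?e = "2/3 :: real"
  have le: "G t = L" if "0 < t" "t \<le> ?e" for t
    using limit_le[OF L, of t] limit_line_le[OF L, of t ?e] that G by simp
  obtain b c where bc: "0 < b" "b < c" "c < 1" "G b < G c" by (rule ex_increase)
  then have "L < G c" using limit_le[OF L, of b] by simp
  then have c: "?e < c" using le[of c] bc by (cases "c \<le> ?e") auto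
  have int: "(\<lambda>t. G t * sin (x * t)) integrable_on {0..1}"
    by (intro int_mult continuous_intros)
  have ints: "(\<lambda>t. L * sin (x * t)) integrable_on {0..1}"
    by (intro integrable_continuous_real continuous_intros)
  have intd: "(\<lambda>t. (G t - L) * sin (x * t)) integrable_on {0..1}"
    using integrable_diff[OF int ints] by (simp add: algebra_simps)
  have "0 < integral {?e..1} (\<lambda>t. (G t - L) * - sin (x * t))"
  proof (rule integral_mult_pos)
    show "mono_on {?e<..<1} (\<lambda>t. G t - L)"
      by (rule mono_onI) (auto intro: mono_onD[OF mono])
    show "?e < c" "c < 1" "0 < G c - L" using c bc \<open>L < G c\<close> by auto
    have "(\<lambda>t. - ((G t - L) * sin (x * t))) integrable_on {?e..1}"
      by (intro integrable_neg integrable_on_subinterval[OF intd]) auto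
    then show "(\<lambda>t. (G t - L) * - sin (x * t)) integrable_on {?e..1}" by simp
    fix t :: real assume t: "?e < t" "t < 1"
    show "0 \<le> G t - L" using limit_le[OF L, of t] t by simp
    have "pi < x * t" "x * t < 2 * pi" using t pi_gt_zero by (auto simp: x)
    then show "0 < - sin (x * t)" using sin_lt_zero[of "x * t"] by simp
  qed (intro continuous_intros)
  moreover have "integral {0..?e} (\<lambda>t. (G t - L) * sin (x * t)) = integral {0..?e} (\<lambda>t. 0)"
    unfolding integral_open_interval_real by (rule integral_cong) (auto simp: le)
  moreover have "integral {0..?e} (\<lambda>t. (G t - L) * sin (x * t)) + integral {?e..1} (\<lambda>t. (G t - L) * sin (x * t))
      = integral {0..1} (\<lambda>t. (G t - L) * sin (x * t))"
    using intd by (intro Henstock_Kurzweil_Integration.integral_combine) auto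
  ultimately have "integral {0..1} (\<lambda>t. (G t - L) * sin (x * t)) < 0" by simp
  moreover have "integral {0..1} (\<lambda>t. (G t - L) * sin (x * t)) =
      integral {0..1} (\<lambda>t. G t * sin (x * t)) - integral {0..1} (\<lambda>t. L * sin (x * t))"
    by (subst integral_diff[symmetric, OF int ints]) (simp add: algebra_simps)
  moreover have "((\<lambda>t. L * sin (x * t)) has_integral - (L * cos (x * 1)) / x - (- (L * cos (x * 0)) / x)) {0..1}"
  proof (rule has_integral_deriv)
    fix t show "((\<lambda>t. - (L * cos (x * t)) / x) has_real_derivative L * sin (x * t)) (at t)"
      by (rule derivative_eq_intros refl | use pi_gt_zero in \<open>simp add: x\<close>)+
  qed simp
  then have eq: "integral {0..1} (\<lambda>t. L * sin (x * t)) = - (L * cos (x * 1)) / x - (- (L * cos (x * 0)) / x)"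
    by (rule integral_unique)
  moreover have "integral {0..1} (\<lambda>t. L * sin (x * t)) = L / x"
    unfolding eq by (simp add: x sin_cos_three_halves_pi)
  ultimately show ?thesis by linarith
qed

text \<open>Here sin x = -1 and V is at most L / x - M - m / x^2, with \<open>m\<close> the slope of
  the comparison line. The condition L \<le> x M is strongest at the smallest such x, namely 3 pi /
  2; this is the origin of \<open>2 * L \<le> 3 * pi * M\<close>.\<close>

lemma V_at_three_quarters:
  assumes L: "(G \<longlongrightarrow> L) (at_right 0)" and LM: "L = 0 \<or> 0 < 2 * L \<and> 2 * L \<le> 3 * pi * M"
    and x: "x = (2 * real j + 3/2) * pi"
  shows "V x < 0"
proof -
  have x0: "0 < x" using x by simp
  have x32: "3 * pi / 2 \<le> x" unfolding x by (simp add: algebra_simps)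
  define c e m where "c = 3 * pi / (2 * x)" and "e = pi / x" and "m = (G e - L) / e"
  have xc: "x * c = 3 * pi / 2" and xe: "x * e = pi"
    using x0 by (auto simp: c_def e_def)
  have c: "0 < c" "c \<le> 1" "c + real j * (2 * pi / x) = 1"
  proof -
    have "c + real j * (2 * pi / x) = (3 * pi / 2 + 2 * real j * pi) / x"
      by (simp add: c_def add_divide_distrib)
    also have "3 * pi / 2 + 2 * real j * pi = x"
      unfolding x by (simp add: algebra_simps)
    finally show "c + real j * (2 * pi / x) = 1" using x0 by simp
  qed (use x0 x32 in \<open>simp_all add: c_def\<close>)
  have "pi < x" using x32 pi_gt_zero by linarith
  then have e: "0 < e" "e < 1"
    using x0 by (simp_all add: e_def)
  have m: "0 \<le> m" using limit_le[OF L, of e] e by (simp add: m_def)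
  have int: "(\<lambda>t. G t * sin (x * t)) integrable_on {0..1}"
    by (intro int_mult continuous_intros)
  have "x = 3 * pi / 2 + of_nat j * (2 * pi)"
    unfolding x by (simp add: algebra_simps)
  then have "sin x = -1"
    using sin.plus_of_nat[of "3 * pi / 2" j] by (simp add: sin_cos_three_halves_pi)
  then have V: "V x = - M + integral {0..1} (\<lambda>t. G t * sin (x * t))"
    by (simp add: V_def)
  have "integral {0..1} (\<lambda>t. G t * sin (x * t)) \<le> L / x - m / x\<^sup>2"
  proof -
    have "integral {0..c} (\<lambda>t. G t * sin (x * t)) \<le> L / x - m / x\<^sup>2"
      unfolding m_def using c by (intro head_integral_le[OF L x0 xc _ xe]) auto
    moreover have "0 \<le> integral {c..1} (\<lambda>t. G t * cos (x * (t - c)))"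
      using x0 c by (intro tail_nonneg) auto
    moreover have "cos (x * (t - c)) = - sin (x * t)" for t
      by (simp add: right_diff_distrib xc cos_diff sin_cos_three_halves_pi)
    moreover have "integral {0..c} (\<lambda>t. G t * sin (x * t)) + integral {c..1} (\<lambda>t. G t * sin (x * t))
        = integral {0..1} (\<lambda>t. G t * sin (x * t))"
      using c int by (intro Henstock_Kurzweil_Integration.integral_combine) auto
    ultimately show ?thesis by simp
  qed
  then have le: "V x \<le> L / x - M - m / x\<^sup>2" using V by simp
  have "L \<le> x * M"
  proof (cases "L = 0")
    case False
    have "3 * pi / 2 * M \<le> x * M" using x32 M_nonneg by (rule mult_right_mono)
    then show ?thesis using LM False by simp
  qed (use x0 M_nonneg in simp)
  then have LxM: "L / x \<le> M" using x0 by (simp add: pos_divide_le_eq mult.commute)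
  \<comment> \<open>Strictness has three sources: the term with \<open>m\<close>; for m = 0 and x =
    3 pi / 2, the nonconstancy of \<open>G\<close>; for m = 0 and larger x, the strict inequality L
    < x M, because then \<open>L = G e > 0\<close> and so \<open>M > 0\<close>.\<close>
  consider "0 < m" | "m = 0" "j = 0" | "m = 0" "0 < j" using m by linarith
  then show ?thesis
  proof cases
    case 1
    then have "0 < m / x\<^sup>2" using x0 by simp
    then show ?thesis using le LxM by linarith
  next
    case 2
    have x3: "x = 3 * pi / 2" using 2 x by simp
    have "G e = L" using 2 e by (simp add: m_def)
    moreover have "e = 2 / 3" unfolding e_def x3 by simp
    ultimately have "G (2 / 3) = L" by simp
    then show ?thesis
      using head_integral_less[OF L x3] V LxM by linarith
  next
    case 3
    then have "L = G e" using e by (simp add: m_def)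
    then have "L > 0" using pos e by simp
    then have "0 < 3 * pi * M" using LM by linarith
    then have M: "0 < M" by (simp add: zero_less_mult_iff)
    have "3 * pi / 2 < x" using 3 x by simp
    then have "3 * pi / 2 * M < x * M" using M by (rule mult_strict_right_mono)
    then have "L < x * M" using LM \<open>L > 0\<close> by simp
    then have "L / x < M" using x0 by (simp add: pos_divide_less_eq mult.commute)
    then show ?thesis using le 3 by simp
  qed
qed

section \<open>Existence, uniqueness and location of the zeros\<close>

text \<open>The factor (-1)^k makes the function start at -A(k pi) < 0 and makes every crossing
  upward, sin x having the sign (-1)^k here. The right end \<open>d\<close> is left free to serve
  both the whole interval and its first half.\<close>

lemma ex1_zero:
  assumes k: "0 < k" and d: "real k * pi < d" "d \<le> (real k + 1) * pi" "0 < (-1) ^ k * V d"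
  shows "\<exists>!x. x \<in> {real k * pi<..<d} \<and> V x = 0"
proof -
  define W where "W x = (-1) ^ k * V x" for x
  have Wd: "(W has_real_derivative (-1) ^ k * V' x) (at x)" for x
    unfolding W_def by (rule DERIV_cmult[OF V_deriv])
  have W0: "W x = 0 \<longleftrightarrow> V x = 0" for x by (simp add: W_def)
  have "0 < A (real k * pi)" using k by (intro A_pos) simp
  then have neg: "W (real k * pi) < 0"
    by (simp add: W_def V_decomp minus_one_power_sandwich)
  have W'pos: "0 < (-1) ^ k * V' x" if x: "real k * pi < x" "x < d" "W x = 0" for x
  proof -
    have "0 < sin (x - real k * pi)" using x d by (intro sin_gt_zero) (auto simp: algebra_simps)
    then have s: "0 < (-1) ^ k * sin x" by (simp add: sin_diff mult.commute)
    have "0 < x" using x(1) by (smt (verit) mult_nonneg_nonneg of_nat_0_le_iff pi_ge_zero)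
    then have "0 < V' x * sin x" using x W0 by (intro zero_deriv_sign) auto
    also have "\<dots> = ((-1) ^ k * V' x) * ((-1) ^ k * sin x)"
      by (simp add: algebra_simps flip: power_mult_distrib)
    finally show ?thesis using s by (metis zero_less_mult_pos2)
  qed
  have le: "z \<le> y" if "y \<in> {real k * pi<..<d}" "z \<in> {real k * pi<..<d}" "V y = 0" "V z = 0" for y z
    using zero_unique_if_deriv_pos[of "real k * pi" d W "\<lambda>x. (-1) ^ k * V' x" y z] Wd W'pos that W0 by auto
  have "continuous_on {real k * pi..d} W"
    using Wd by (intro DERIV_continuous_on) (rule has_field_derivative_at_within)
  moreover have "0 < W d" using d by (simp add: W_def)
  ultimately obtain x where x: "real k * pi \<le> x" "x \<le> d" "W x = 0"
    using IVT'[of W "real k * pi" 0 d] neg d by auto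
  then have "x \<noteq> real k * pi" "x \<noteq> d" using neg \<open>0 < W d\<close> by auto
  then have "x \<in> {real k * pi<..<d}" "V x = 0" using x W0 by auto
  then show ?thesis using le by (intro ex1I[of _ x]) (auto intro: antisym)
qed

lemma V_at_next:
  "0 < (-1) ^ k * V ((real k + 1) * pi)"
proof -
  have "0 < A (real (Suc k) * pi)" by (intro A_pos) simp
  moreover have "V (real (Suc k) * pi) = - A (real (Suc k) * pi) * (-1) ^ Suc k"
    unfolding V_decomp by (simp only: sin_npi cos_npi)
  ultimately show ?thesis
    by (simp add: add.commute minus_one_power_sandwich)
qed

lemma zero_location:
  assumes x: "0 < x" "V x = 0"
  shows "\<exists>k>0. real k * pi < x \<and> x < (real k + 1) * pi"
proof -
  define k where "k = nat \<lfloor>x / pi\<rfloor>"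
  have k: "real k = of_int \<lfloor>x / pi\<rfloor>" using x by (simp add: k_def)
  have "real k \<le> x / pi" "x / pi < real k + 1" unfolding k by linarith+
  then have b: "real k * pi \<le> x" "x < (real k + 1) * pi"
    by (auto simp: field_simps)
  have "pi < x" using V_pos[of x] x by force
  then have k0: "0 < k" using b by (cases k) auto
  then have "0 < A (real k * pi)" by (intro A_pos) simp
  then have "V (real k * pi) \<noteq> 0"
    unfolding V_decomp by simp
  then have "x \<noteq> real k * pi" using x by auto
  then show ?thesis using b k0 by force
qed

end


section \<open>Transfer to the given function f\<close>

lemma constant_on_not_general:
  assumes "g constant_on {0<..<1}"
  shows "\<not> general_case g"
proof -
  have "exceptional_case g"
    unfolding exceptional_case_def
    \<comment> \<open>The trivial partition with points 0 and 1; \<open>real\<close> lists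
      them.\<close>
    by (rule exI[of _ 1], rule exI[of _ real]) (use assms in auto)
  then show ?thesis by (simp add: general_case_def)
qed

theorem theorem6p1:
  fixes f U :: "real \<Rightarrow> real" and L M :: real
  assumes f_pos: "\<And>t. t \<in> {0<..<1} \<Longrightarrow> f t > 0"
    and f_diff: "f differentiable_on {0<..<1}"
    and g_pos: "\<And>t. t \<in> {0<..<1} \<Longrightarrow> - deriv f t > 0"
    and g_incr: "mono_on {0<..<1} (\<lambda>t. - deriv f t)"
    and g_convex: "convex_on {0<..<1} (\<lambda>t. - deriv f t)"
    and g_general: "general_case (\<lambda>t. - deriv f t)"
    and g_integrable: "(\<lambda>t. - deriv f t) integrable_on {0<..<1}"
    and U_eq: "U = cos_transform f"
    and L_eq: "L = Lim (at_right 0) (\<lambda>t. - deriv f t)"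
    and M_eq: "M = Lim (at_left 1) f"
  shows "(\<forall>x. 0 < x \<and> x \<le> pi \<longrightarrow> U x > 0) \<and>
    infinite {x. x > pi \<and> U x = 0} \<and>
    (\<forall>x>pi. U x = 0 \<longrightarrow> simple_zero U x) \<and>
    ((\<forall>k::nat. k \<ge> 1 \<longrightarrow>
        (\<exists>!x. x \<in> {(2 * real k - 1) * pi<..<2 * real k * pi} \<and> U x = 0) \<and>
        (\<exists>!x. x \<in> {2 * real k * pi<..<(2 * real k + 1/2) * pi} \<and> U x = 0)) \<and>
     (\<forall>x>0. U x = 0 \<longrightarrow>
        (\<exists>k::nat. k \<ge> 1 \<and>
           x \<in> {(2 * real k - 1) * pi<..<2 * real k * pi} \<union>
               {2 * real k * pi<..<(2 * real k + 1/2) * pi}))) \<and>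
    (L = 0 \<or> (0 < 2 * L \<and> 2 * L \<le> 3 * pi * M) \<longrightarrow>
      (\<forall>k::nat. k \<ge> 1 \<longrightarrow>
        (\<exists>!x. x \<in> {real k * pi<..<(real k + 1/2) * pi} \<and> U x = 0)) \<and>
      (\<forall>x>0. U x = 0 \<longrightarrow>
        (\<exists>k::nat. k \<ge> 1 \<and> x \<in> {real k * pi<..<(real k + 1/2) * pi})))"
proof -
  define G where "G t = (if 0 < t \<and> t < 1 then - deriv f t else 0)" for t
  have Gf: "G t = - deriv f t" if "t \<in> {0<..<1}" for t
    using that by (simp add: G_def)
  have f_deriv: "(f has_real_derivative - G t) (at t)" if t: "0 < t" "t < 1" for t
  proof -
    have "f differentiable (at t)"
      using f_diff t by (simp add: differentiable_on_eq_differentiable_at)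
    then have "(f has_real_derivative deriv f t) (at t)"
      using DERIV_deriv_iff_real_differentiable by blast
    then show ?thesis using t by (simp add: G_def)
  qed
  \<comment> \<open>\<open>K\<close> is arbitrary because \<open>M\<close> is not yet known to be a
    limit, nor to be nonnegative; the instance with 0 serves to find that limit.\<close>
  have base: "convex_density G K" if "0 \<le> K" for K
  proof
    show "mono_on {0<..<1} G"
      using g_incr by (simp add: mono_on_def G_def)
    show "convex_on {0<..<1} G"
      using g_convex unfolding convex_on_def by (metis (no_types, lifting) Gf convexD)
    have "(\<lambda>t. - deriv f t) integrable_on {0..1}"
      using g_integrable by (simp add: integrable_on_Icc_iff_Ioo)
    then show "G integrable_on {0..1}"
      unfolding integrable_on_Icc_iff_Ioo by (rule integrable_eq) (simp add: G_def)
    show "\<not> G constant_on {0<..<1}"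
    proof
      assume "G constant_on {0<..<1}"
      then have "(\<lambda>t. - deriv f t) constant_on {0<..<1}"
        unfolding constant_on_def by (metis Gf)
      then show False using g_general constant_on_not_general by blast
    qed
  qed (use that g_pos in \<open>auto simp: G_def\<close>)
  \<comment> \<open>Both functions have derivative -\<open>G\<close>, so they differ by a
    constant.\<close>
  obtain \<kappa> where \<kappa>: "\<And>t. t \<in> {0<..<1} \<Longrightarrow> f t = \<kappa> + convex_density.F G 0 t"
  proof -
    interpret D0: convex_density G 0 by (rule base) simp
    have "\<exists>c. \<forall>t\<in>{0<..<1}. f t - D0.F t = c"
    proof (rule has_field_derivative_zero_constant)
      fix t :: real assume "t \<in> {0<..<1}"
      then have "((\<lambda>t. f t - D0.F t) has_real_derivative - G t - - G t) (at t)"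
        by (intro DERIV_diff f_deriv D0.F_deriv) auto
      then show "((\<lambda>t. f t - D0.F t) has_real_derivative 0) (at t within {0<..<1})"
        by (simp add: has_field_derivative_at_within)
    qed simp
    then show ?thesis using that by (metis add.commute diff_add_cancel)
  qed
  \<comment> \<open>\<open>M\<close> is a \<open>Lim\<close>, which is informative only once
    convergence is proved; \<open>D0.F\<close> vanishes at 1, so the limit is
    \<open>\<kappa>\<close>.\<close>
  have lim: "(f \<longlongrightarrow> \<kappa>) (at_left 1)"
  proof -
    interpret D0: convex_density G 0 by (rule base) simp
    have "(D0.F \<longlongrightarrow> D0.F 1) (at 1 within {0..1})"
      using D0.F_cont unfolding continuous_on by (rule bspec) simp
    then have "((\<lambda>t. \<kappa> + D0.F t) \<longlongrightarrow> \<kappa> + 0) (at_left 1)"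
      by (intro tendsto_add tendsto_const) (simp add: at_within_Icc_at_left)
    moreover have "\<forall>\<^sub>F t in at_left 1. \<kappa> + D0.F t = f t"
      using eventually_at_left_real[OF zero_less_one] by eventually_elim (simp add: \<kappa>)
    ultimately show ?thesis by (simp add: filterlim_cong)
  qed
  then have M: "M = \<kappa>" unfolding M_eq by (intro tendsto_Lim) simp_all
  have "0 \<le> \<kappa>"
  proof (rule tendsto_lowerbound[OF lim])
    show "\<forall>\<^sub>F t in at_left 1. 0 \<le> f t"
      using eventually_at_left_real[OF zero_less_one]
      by eventually_elim (use f_pos in \<open>auto intro: less_imp_le\<close>)
  qed simp
  then interpret D: convex_density G M unfolding M by (rule base)
  have fF: "f t = D.F t" if "t \<in> {0<..<1}" for t
    using \<kappa>[OF that] M unfolding D.F_def convex_density.F_def[OF base[OF order_refl]] by simp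
  have UD: "U = D.U"
    unfolding U_eq cos_transform_def D.U_def integral_open_interval_real
    by (intro ext integral_cong) (simp add: fF)
  have U0: "U x = 0 \<longleftrightarrow> D.V x = 0" if "0 < x" for x
    using that by (simp add: UD D.V_eq)
  have ex1: "\<exists>!x. x \<in> {real k * pi<..<d} \<and> U x = 0"
    if "0 < k" "real k * pi < d" "d \<le> (real k + 1) * pi" "0 < (-1) ^ k * D.V d" for k d
  proof -
    have "0 < x" if "x \<in> {real k * pi<..<d}" for x
      using that by (auto intro: le_less_trans[of 0 "real k * pi"])
    then show ?thesis using D.ex1_zero[OF that] U0 by metis
  qed
  have full: "\<exists>!x. x \<in> {real k * pi<..<(real k + 1) * pi} \<and> U x = 0" if "0 < k" for k
    using that by (intro ex1 D.V_at_next) (simp_all add: algebra_simps)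
  have half: "\<exists>!x. x \<in> {real k * pi<..<(real k + 1/2) * pi} \<and> U x = 0"
    if "0 < k" "0 < (-1) ^ k * D.V ((real k + 1/2) * pi)" for k
    using that by (intro ex1) (simp_all add: algebra_simps)
  have loc: "\<exists>k>0. x \<in> {real k * pi<..<(real k + 1) * pi}" if "0 < x" "U x = 0" for x
    using D.zero_location[of x] that U0 by auto
  \<comment> \<open>The zero in the half interval is also a zero in the whole interval, where there
    is only one.\<close>
  have loc_half: "x \<in> {real k * pi<..<(real k + 1/2) * pi}"
    if k: "0 < k" "0 < (-1) ^ k * D.V ((real k + 1/2) * pi)"
      and x: "x \<in> {real k * pi<..<(real k + 1) * pi}" "U x = 0" for k x
  proof -
    obtain y where y: "y \<in> {real k * pi<..<(real k + 1/2) * pi}" "U y = 0"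
      using half[OF k] by blast
    then have "y \<in> {real k * pi<..<(real k + 1) * pi}" by (auto simp: algebra_simps)
    then have "x = y" using full[OF k(1)] x y(2) by blast
    then show ?thesis using y by simp
  qed
  have even_half: "0 < (-1) ^ (2 * j) * D.V ((real (2 * j) + 1/2) * pi)" for j
    using D.V_at_quarter[OF refl, of j] by simp
  have "\<forall>x. 0 < x \<and> x \<le> pi \<longrightarrow> U x > 0"
  proof (intro allI impI)
    fix x assume "0 < x \<and> x \<le> pi"
    then show "0 < U x" using D.V_pos[of x] by (simp add: UD D.V_eq zero_less_mult_iff)
  qed
  moreover have "infinite {x. x > pi \<and> U x = 0}"
  proof
    assume "finite {x. x > pi \<and> U x = 0}"
    then obtain b where b: "\<And>x. x > pi \<Longrightarrow> U x = 0 \<Longrightarrow> x \<le> b"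
      using bdd_above_finite[of "{x. x > pi \<and> U x = 0}"] by (auto simp: bdd_above_def)
    obtain k where k: "b / pi < real k" using reals_Archimedean2 by blast
    obtain x where x: "real (Suc k) * pi < x" "U x = 0"
      using full[of "Suc k"] by (auto simp del: of_nat_Suc)
    have "1 * pi \<le> real (Suc k) * pi" "real k * pi \<le> real (Suc k) * pi"
      by (intro mult_right_mono; simp)+
    moreover have "b < real k * pi" using k by (simp add: pos_divide_less_eq)
    ultimately show False using b[of x] x by linarith
  qed
  moreover have "\<forall>x>pi. U x = 0 \<longrightarrow> simple_zero U x"
  proof (intro allI impI)
    fix x assume x: "pi < x" "U x = 0"
    then have x0: "0 < x" using pi_gt_zero by linarith
    \<comment> \<open>At a zero of \<open>U\<close> the product rule leaves V' = x U', so simplicity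
      follows from \<open>D.zero_deriv_sign\<close>.\<close>
    obtain u where u: "(U has_real_derivative u) (at x)" using D.U_deriv UD by blast
    then have "((\<lambda>x. x * U x) has_real_derivative 1 * U x + u * x) (at x)"
      by (intro DERIV_mult DERIV_ident)
    moreover have "D.V = (\<lambda>x. x * U x)" using D.V_eq UD by auto
    ultimately have "D.V' x = 1 * U x + u * x" using D.V_deriv[of x] by (metis DERIV_unique)
    then have "D.V' x = u * x" using x by simp
    moreover have "0 < D.V' x * sin x" using D.zero_deriv_sign[OF x0] U0[OF x0] x(2) by simp
    ultimately have "u \<noteq> 0" by auto
    then show "simple_zero U x" using x u by (auto simp: simple_zero_def)
  qed
  moreover have "(\<forall>k::nat. k \<ge> 1 \<longrightarrow>
        (\<exists>!x. x \<in> {(2 * real k - 1) * pi<..<2 * real k * pi} \<and> U x = 0) \<and>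
        (\<exists>!x. x \<in> {2 * real k * pi<..<(2 * real k + 1/2) * pi} \<and> U x = 0))"
  proof (intro allI impI)
    fix k :: nat assume k: "k \<ge> 1"
    \<comment> \<open>\<open>k \<ge> 1\<close> makes the natural subtraction exact. Odd indices use
      the whole interval, even ones its first half.\<close>
    have "real (2 * k - 1) = 2 * real k - 1" using k by (simp add: of_nat_diff)
    then show "(\<exists>!x. x \<in> {(2 * real k - 1) * pi<..<2 * real k * pi} \<and> U x = 0) \<and>
        (\<exists>!x. x \<in> {2 * real k * pi<..<(2 * real k + 1/2) * pi} \<and> U x = 0)"
      using full[of "2 * k - 1"] half[OF _ even_half, of k] k by simp
  qed
  moreover have "\<forall>x>0. U x = 0 \<longrightarrow>
        (\<exists>k::nat. k \<ge> 1 \<and>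
           x \<in> {(2 * real k - 1) * pi<..<2 * real k * pi} \<union>
               {2 * real k * pi<..<(2 * real k + 1/2) * pi})"
  proof (intro allI impI)
    fix x assume x: "0 < x" "U x = 0"
    then obtain n where n: "0 < n" "x \<in> {real n * pi<..<(real n + 1) * pi}" using loc by blast
    show "\<exists>k::nat. k \<ge> 1 \<and>
           x \<in> {(2 * real k - 1) * pi<..<2 * real k * pi} \<union>
               {2 * real k * pi<..<(2 * real k + 1/2) * pi}"
    proof (cases "even n")
      case True
      then obtain j where j: "n = 2 * j" by blast
      then have "x \<in> {real (2 * j) * pi<..<(real (2 * j) + 1/2) * pi}"
        using n x even_half by (intro loc_half) auto
      then show ?thesis using j n by (intro exI[of _ j]) auto
    next
      case False
      then obtain j where "n = 2 * j + 1" by (rule oddE)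
      then show ?thesis using n by (intro exI[of _ "j + 1"]) (auto simp: algebra_simps)
    qed
  qed
  moreover have "(\<forall>k::nat. k \<ge> 1 \<longrightarrow>
        (\<exists>!x. x \<in> {real k * pi<..<(real k + 1/2) * pi} \<and> U x = 0)) \<and>
      (\<forall>x>0. U x = 0 \<longrightarrow>
        (\<exists>k::nat. k \<ge> 1 \<and> x \<in> {real k * pi<..<(real k + 1/2) * pi}))"
    if LM: "L = 0 \<or> (0 < 2 * L \<and> 2 * L \<le> 3 * pi * M)"
  proof -
    have at0: "at 0 within ({0<..} \<inter> {0<..<1}) = at_right (0::real)"
      by (rule at_within_nhd[of 0 "{-1<..<1}"]) auto
    \<comment> \<open>\<open>L\<close> too is a \<open>Lim\<close>: existence of the limit comes
      from monotonicity and the lower bound 0.\<close>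
    have "(G \<longlongrightarrow> Inf (G ` ({0<..} \<inter> {0<..<1}))) (at 0 within ({0<..} \<inter> {0<..<1}))"
      by (rule Lim_right_bound[where K = 0]) (auto intro: mono_onD[OF D.mono] D.nonneg)
    then obtain l where l: "(G \<longlongrightarrow> l) (at_right 0)" unfolding at0 by blast
    moreover have "\<forall>\<^sub>F t in at_right 0. G t = - deriv f t"
      using eventually_at_right_real[OF zero_less_one] by eventually_elim (rule Gf)
    ultimately have "((\<lambda>t. - deriv f t) \<longlongrightarrow> l) (at_right 0)"
      by (rule Lim_transform_eventually)
    then have "L = l" unfolding L_eq by (intro tendsto_Lim) simp_all
    then have L: "(G \<longlongrightarrow> L) (at_right 0)" using l by simp
    have sgn: "0 < (-1) ^ k * D.V ((real k + 1/2) * pi)" for k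
    proof (cases "even k")
      case True
      then obtain j where "k = 2 * j" by blast
      then show ?thesis using even_half[of j] by simp
    next
      case False
      then obtain j where j: "k = 2 * j + 1" by (rule oddE)
      then have "D.V ((real k + 1/2) * pi) < 0"
        by (intro D.V_at_three_quarters[OF L LM, of _ j]) simp
      then show ?thesis using j by simp
    qed
    show ?thesis
    proof (intro conjI allI impI)
      fix k :: nat assume "k \<ge> 1"
      then show "\<exists>!x. x \<in> {real k * pi<..<(real k + 1/2) * pi} \<and> U x = 0"
        by (intro half sgn) simp
    next
      fix x assume x: "0 < x" "U x = 0"
      then obtain n where n: "0 < n" "x \<in> {real n * pi<..<(real n + 1) * pi}" using loc by blast
      then have "x \<in> {real n * pi<..<(real n + 1/2) * pi}"
        using x by (intro loc_half sgn)
      then show "\<exists>k::nat. k \<ge> 1 \<and> x \<in> {real k * pi<..<(real k + 1/2) * pi}"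
        using n(1) by (intro exI[of _ n]) simp
    qed
  qed
  ultimately show ?thesis by blast
qed

end
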